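(* For all $n\in\mathbb{Z}_+$ and all complex $\lambda\notin\{\frac45,1\}$, the characteristic polynomial $p_n(\lambda)=\det(\lambda I-Z_n)$ satisfies $$ p_n(\lambda)=\frac12 (\lambda-1)^{n-1}+(\lambda-1)^n-\frac{\lambda (1-\lambda)^n}{8-18\lambda+10\lambda^2}+\frac{2^{-n}\big(-2+3\lambda-\sqrt\lambda \sqrt{5\lambda-4}\big)^n+2^{-n}\big(-2+3\lambda +\sqrt\lambda \sqrt{5\lambda-4}\big)^n}{4-5\lambda}. $$
   Context: Let $(F_k)_{k\ge 1}$ be the Fibonacci numbers, $F_1=F_2=1$ and $F_k=F_{k-1}+F_{k-2}$ for $k\geq 3$. For each positive integer $n$, $Z_n$ is the real symmetric $n\times n$ matrix defined elementwise, for $i,j\in\{1,\ldots,n\}$, by $$ (Z_n)_{i,j}=\begin{cases} 1+\sum_{k=i+1}^nF_{k-i}^2&\text{if }i=j,\\ (-1)^{j-i}\big(F_{j-i}+\sum_{k=j+1}^nF_{k-i}F_{k-j}\big)&\text{if }i<j,\\ (-1)^{i-j}\big(F_{i-j}+\sum_{k=i+1}^nF_{k-i}F_{k-j}\big)&\text{if }i>j, \end{cases} $$ where empty sums are $0$. $I$ is the $n\times n$ identity matrix. Square roots denote (complex) principal square roots; the right-hand side does not depend on the choice of branches. *)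

theory Defs
  imports
    Complex_Main
    "HOL-Number_Theory.Fib"
    "Jordan_Normal_Form.Char_Poly"
begin

text \<open>In \<open>Z_entry n i j\<close> the indices \<open>i\<close> and \<open>j\<close> run from \<open>1\<close> to \<open>n\<close>; natural-number subtraction
  only occurs where it does not truncate.\<close>

definition Z_entry :: "nat \<Rightarrow> nat \<Rightarrow> nat \<Rightarrow> real" where
  "Z_entry n i j =
    (if i = j then 1 + (\<Sum>k = i + 1..n. real (fib (k - i)) ^ 2)
     else if i < j then
       (-1) ^ (j - i) * (real (fib (j - i)) + (\<Sum>k = j + 1..n. real (fib (k - i)) * real (fib (k - j))))
     else
       (-1) ^ (i - j) * (real (fib (i - j)) + (\<Sum>k = i + 1..n. real (fib (k - i)) * real (fib (k - j)))))"

text \<open>Library matrices are indexed from \<open>0\<close>, hence the shift.\<close>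

definition Z :: "nat \<Rightarrow> real mat" where
  "Z n = mat n n (\<lambda>(i, j). Z_entry n (i + 1) (j + 1))"

text \<open>Evaluation of the library's characteristic polynomial at \<open>x\<close> is the determinant of \<open>x I - A\<close>.\<close>

lemma poly_char_poly_eq_det:
  fixes A :: "'a :: comm_ring_1 mat"
  assumes A: "A \<in> carrier_mat n n"
  shows "poly (char_poly A) x = det (x \<cdot>\<^sub>m 1\<^sub>m n - A)"
  unfolding char_poly_def
  by (rule poly_det_cong[of _ n]) (use A in \<open>auto simp: char_poly_matrix_def\<close>)

end

theory Submission
  imports Defs "HOL-Computational_Algebra.Formal_Power_Series"
begin

text \<open>The matrix \<open>Z n\<close> is a Gram matrix \<open>U U\<^sup>T\<close>, where \<open>U\<close> is the upper triangular Toeplitz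
  matrix with first row \<open>1, -F\<^sub>1, F\<^sub>2, -F\<^sub>3, \<dots>\<close>. In terms of the nilpotent shift \<open>N\<close>, the generating
  function of the Fibonacci numbers gives \<open>B U = A\<close> with \<open>B = 1 + N - N\<^sup>2\<close> and \<open>A = 1 - N\<^sup>2\<close>. Since
  \<open>det B = 1\<close>, the characteristic polynomial at \<open>z\<close> is
  \<open>det (B (z I - Z n) B\<^sup>T) = det (z B B\<^sup>T - A A\<^sup>T)\<close>, and the matrix on the right is sparse:
  apart from its last \<open>2 \<times> 2\<close> block it has only the constants \<open>3z - 2\<close> on the diagonal
  and \<open>1 - z\<close> at distance two from it (\<open>poly_char_poly_Z\<close>).

  Expanding that determinant from the top left corner gives a linear recurrence of order four in \<open>n\<close>
  (\<open>det_sparse_mat_rec\<close>). With \<open>a = 3z - 2\<close> and \<open>w = z - 1\<close> its characteristic polynomial is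
  \<open>x\<^sup>4 - a x\<^sup>3 + a w\<^sup>2 x - w\<^sup>4 = (x\<^sup>2 - w\<^sup>2) (x\<^sup>2 - a x + w\<^sup>2)\<close>. The roots are \<open>w\<close>, \<open>-w\<close> and the
  two numbers \<open>(3z - 2 \<plusminus> \<surd>z \<surd>(5z - 4)) / 2\<close>, because \<open>a\<^sup>2 - 4 w\<^sup>2 = z (5z - 4)\<close>. The claimed formula is a
  linear combination of powers of these roots, so it satisfies the same recurrence, and it remains
  to compare the values for \<open>n \<le> 3\<close> (\<open>det_sparse_mat_closed_form\<close>).\<close>

unbundle fps_syntax
no_notation vec_index (infixl "$" 100)

section \<open>Upper triangular Toeplitz matrices\<close>

text \<open>Indexing by a formal power series \<open>F\<close> makes this the evaluation of \<open>F\<close> at the nilpotent shift,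
  so that matrix products become products of series.\<close>

definition toeplitz :: "nat \<Rightarrow> 'a :: comm_ring_1 fps \<Rightarrow> 'a mat" where
  "toeplitz n F = mat n n (\<lambda>(i, j). if i \<le> j then F $ (j - i) else 0)"

lemma toeplitz_carrier [simp]: "toeplitz n F \<in> carrier_mat n n"
  by (simp add: toeplitz_def)

lemma dim_toeplitz [simp]: "dim_row (toeplitz n F) = n" "dim_col (toeplitz n F) = n"
  by (simp_all add: toeplitz_def)

lemma index_toeplitz:
  "i < n \<Longrightarrow> j < n \<Longrightarrow> toeplitz n F $$ (i, j) = (if i \<le> j then F $ (j - i) else 0)"
  by (simp add: toeplitz_def)

lemma toeplitz_mult: "toeplitz n F * toeplitz n G = toeplitz n (F * G)"
proof (rule eq_matI)
  fix i j assume "i < dim_row (toeplitz n (F * G))" "j < dim_col (toeplitz n (F * G))"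
  hence ij: "i < n" "j < n" by auto
  have "(toeplitz n F * toeplitz n G) $$ (i, j) =
      (\<Sum>k\<in>{0..<n}. (if i \<le> k then F $ (k - i) else 0) * (if k \<le> j then G $ (j - k) else 0))"
    using ij by (simp add: scalar_prod_def index_toeplitz)
  also have "\<dots> = (\<Sum>k\<in>{i..j}. F $ (k - i) * G $ (j - k))"
    using ij by (intro sum.mono_neutral_cong_right) auto
  also have "\<dots> = (if i \<le> j then (F * G) $ (j - i) else 0)"
  proof (cases "i \<le> j")
    case True
    have "(\<Sum>k\<in>{i..j}. F $ (k - i) * G $ (j - k)) = (\<Sum>d\<in>{0..j - i}. F $ d * G $ (j - i - d))"
      using True
      by (intro sum.reindex_bij_witness[of _ "\<lambda>d. d + i" "\<lambda>k. k - i"]) auto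
    thus ?thesis using True by (simp add: fps_mult_nth)
  qed simp
  also have "\<dots> = toeplitz n (F * G) $$ (i, j)"
    using ij by (simp add: index_toeplitz)
  finally show "(toeplitz n F * toeplitz n G) $$ (i, j) = toeplitz n (F * G) $$ (i, j)" .
qed auto

lemma det_toeplitz: "det (toeplitz n F) = (F $ 0) ^ n"
proof -
  have "det (toeplitz n F) = prod_list (diag_mat (toeplitz n F))"
    by (rule det_upper_triangular[of _ n]) (auto simp: index_toeplitz)
  also have "\<dots> = (F $ 0) ^ n"
    by (simp add: prod_list_diag_prod index_toeplitz)
  finally show ?thesis .
qed

lemma index_toeplitz_gram:
  assumes "i < n" "j < n"
  shows "(toeplitz n F * transpose_mat (toeplitz n F)) $$ (i, j) =
    (\<Sum>k = max i j..<n. F $ (k - i) * F $ (k - j))"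
proof -
  have "(toeplitz n F * transpose_mat (toeplitz n F)) $$ (i, j) =
      (\<Sum>k\<in>{0..<n}. (if i \<le> k then F $ (k - i) else 0) * (if j \<le> k then F $ (k - j) else 0))"
    using assms by (simp add: scalar_prod_def index_toeplitz)
  also have "\<dots> = (\<Sum>k = max i j..<n. F $ (k - i) * F $ (k - j))"
    using assms by (intro sum.mono_neutral_cong_right) auto
  finally show ?thesis .
qed

text \<open>For a series of degree at most two, a row of the Gram matrix sees the lower end of the
  matrix only through its last two positions; hence the entry depends on the distance \<open>e\<close> from the
  diagonal and on the number \<open>p\<close> of remaining columns, capped at three.\<close>

lemma index_toeplitz_gram_quadratic:
  fixes F :: "'a :: comm_ring_1 fps"
  assumes F: "\<And>d. d \<ge> 3 \<Longrightarrow> F $ d = 0" and ij: "i < n" "j < n"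
    and e_def: "e = max i j - min i j" and p_def: "p = n - max i j"
  shows "(toeplitz n F * transpose_mat (toeplitz n F)) $$ (i, j) =
    F $ e * F $ 0 + (if p \<ge> 2 then F $ (e + 1) * F $ 1 else 0)
      + (if p \<ge> 3 then F $ (e + 2) * F $ 2 else 0)"
proof -
  have p: "p \<ge> 1" using ij by (simp add: p_def)
  have "(\<Sum>k = max i j..<n. F $ (k - i) * F $ (k - j)) = (\<Sum>d<p. F $ (e + d) * F $ d)"
    by (rule sum.reindex_bij_witness[of _ "\<lambda>d. d + max i j" "\<lambda>k. k - max i j"])
       (auto simp: e_def p_def max_def min_def mult.commute)
  also have "\<dots> = (\<Sum>d<min p 3. F $ (e + d) * F $ d)"
    using F by (intro sum.mono_neutral_right) auto
  also have "\<dots> = F $ e * F $ 0 + (if p \<ge> 2 then F $ (e + 1) * F $ 1 else 0)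
        + (if p \<ge> 3 then F $ (e + 2) * F $ 2 else 0)"
  proof -
    consider "p = 1" | "p = 2" | "p \<ge> 3" using p by linarith
    thus ?thesis by cases (simp_all add: numeral_2_eq_2 numeral_3_eq_3 min_def)
  qed
  finally show ?thesis
    by (simp only: index_toeplitz_gram[OF ij])
qed

section \<open>Reduction of \<open>Z n\<close> to a sparse matrix\<close>

text \<open>The constant term is \<open>1\<close> rather than \<open>fib 0 = 0\<close>; as a rational function the series is
  \<open>(1 - X\<^sup>2) / (1 + X - X\<^sup>2)\<close>, the quotient of the two polynomials that follow.\<close>

definition fib_fps :: "'a :: comm_ring_1 fps" where
  "fib_fps = Abs_fps (\<lambda>d. if d = 0 then 1 else (-1) ^ d * of_nat (fib d))"

definition fib_den :: "'a :: comm_ring_1 fps" where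
  "fib_den = 1 + fps_X - fps_X ^ 2"

definition fib_num :: "'a :: comm_ring_1 fps" where
  "fib_num = 1 - fps_X ^ 2"

lemma fib_den_nth: "(fib_den :: 'a :: comm_ring_1 fps) $ d =
    (if d = 0 \<or> d = 1 then 1 else if d = 2 then -1 else 0)"
  by (auto simp: fib_den_def fps_X_power_nth)

lemma fib_num_nth: "(fib_num :: 'a :: comm_ring_1 fps) $ d =
    (if d = 0 then 1 else if d = 2 then -1 else 0)"
  by (auto simp: fib_num_def fps_X_power_nth)

text \<open>From degree three on this is the Fibonacci recurrence with alternating signs. The altered
  constant term of \<open>fib_fps\<close> is responsible for the numerator \<open>1 - X\<^sup>2\<close>.\<close>

lemma fib_den_mult_fib_fps: "fib_den * fib_fps = (fib_num :: 'a :: comm_ring_1 fps)"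
proof (rule fps_ext)
  fix d :: nat
  have *: "(fib_den * fib_fps :: 'a fps) $ d = fib_fps $ d
      + (if d = 0 then 0 else fib_fps $ (d - 1)) - (if d < 2 then 0 else fib_fps $ (d - 2))"
    by (simp add: fib_den_def ring_distribs fps_X_power_mult_nth)
  consider "d = 0" | "d = 1" | "d = 2" | m where "d = m + 3"
    by (metis One_nat_def Suc_1 add.commute add_2_eq_Suc' less_2_cases linorder_not_less
        le_Suc_ex numeral_3_eq_3 not_less_eq_eq le_antisym)
  thus "(fib_den * fib_fps :: 'a fps) $ d = fib_num $ d"
  proof cases
    case 4
    have f: "fib (m + 3) = fib (m + 2) + fib (m + 1)" by (simp add: numeral_3_eq_3)
    show ?thesis unfolding * using 4
      by (simp add: fib_fps_def fib_num_nth f algebra_simps power_add numeral_2_eq_2 numeral_3_eq_3)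
  qed (unfold *, simp_all add: fib_fps_def fib_num_nth numeral_2_eq_2)
qed

text \<open>The term \<open>k = max i j\<close> of the Gram sum gives the isolated summand in \<open>Z_entry\<close>, and all
  terms carry the common sign \<open>(-1) ^ \<bar>i - j\<bar>\<close>.\<close>

lemma Z_eq_toeplitz_gram:
  "map_mat complex_of_real (Z n) = toeplitz n fib_fps * transpose_mat (toeplitz n fib_fps)"
proof (rule eq_matI)
  fix i j assume "i < dim_row (toeplitz n fib_fps * transpose_mat (toeplitz n (fib_fps :: complex fps)))"
    "j < dim_col (toeplitz n fib_fps * transpose_mat (toeplitz n (fib_fps :: complex fps)))"
  hence ij: "i < n" "j < n" by auto
  let ?u = "\<lambda>d. (fib_fps :: complex fps) $ d"
  have shift: "(\<Sum>k = m + 1 + 1..n. g k) = (\<Sum>k = Suc m..<n. g (k + 1))" for g :: "nat \<Rightarrow> complex" and m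
    by (rule sum.reindex_bij_witness[of _ "\<lambda>k. k + 1" "\<lambda>k. k - 1"]) auto
  have sgn: "(-1) ^ (k - i) * (-1) ^ (k - j) = ((-1) ^ (max i j - min i j) :: complex)"
    if "k \<ge> i" "k \<ge> j" for k
    using that by (simp add: minus_one_power_iff max_def min_def)
  have "complex_of_real (Z_entry n (i + 1) (j + 1)) = (\<Sum>k = max i j..<n. ?u (k - i) * ?u (k - j))"
  proof -
    have split: "(\<Sum>k = max i j..<n. ?u (k - i) * ?u (k - j)) =
        ?u (max i j - i) * ?u (max i j - j) + (\<Sum>k = Suc (max i j)..<n. ?u (k - i) * ?u (k - j))"
      using ij by (intro sum.atLeast_Suc_lessThan) auto
    have tail: "(\<Sum>k = Suc (max i j)..<n. ?u (k - i) * ?u (k - j)) =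
        (-1) ^ (max i j - min i j) *
        (\<Sum>k = Suc (max i j)..<n. of_nat (fib (k - i)) * of_nat (fib (k - j)))"
      unfolding sum_distrib_left
    proof (intro sum.cong refl)
      fix k assume "k \<in> {Suc (max i j)..<n}"
      hence "k > i" "k > j" by auto
      thus "?u (k - i) * ?u (k - j) =
          (-1) ^ (max i j - min i j) * (of_nat (fib (k - i)) * of_nat (fib (k - j)))"
        by (simp add: fib_fps_def sgn[of k, symmetric])
    qed
    have Zent: "complex_of_real (Z_entry n (i + 1) (j + 1)) =
        ?u (max i j - i) * ?u (max i j - j) + (-1) ^ (max i j - min i j) *
        (\<Sum>k = Suc (max i j)..<n. of_nat (fib (k - i)) * of_nat (fib (k - j)))"
      by (cases i j rule: linorder_cases)
         (simp_all add: Z_entry_def shift[simplified] fib_fps_def max_def min_def power2_eq_square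
           ring_distribs)
    show ?thesis unfolding split tail Zent ..
  qed
  thus "map_mat complex_of_real (Z n) $$ (i, j) =
      (toeplitz n fib_fps * transpose_mat (toeplitz n fib_fps)) $$ (i, j)"
    using ij by (simp add: Z_def index_toeplitz_gram del: index_mult_mat)
qed (auto simp: Z_def)

text \<open>Here \<open>p\<close> and \<open>q\<close> count rows and columns from the lower right corner, starting with \<open>1\<close>.
  The irregular entries sit in that corner, so with this count the entries do not depend on the
  size of the matrix, and deleting the first row and column leaves a matrix of the same family.\<close>

definition tail_entry :: "'a :: comm_ring_1 \<Rightarrow> nat \<Rightarrow> nat \<Rightarrow> 'a" where
  "tail_entry z p q =
    (if p = q then (if p = 1 then z - 1 else if p = 2 then 2 * z - 1 else 3 * z - 2)
     else if p = q + 2 \<or> q = p + 2 then 1 - z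
     else if p = 1 \<and> q = 2 \<or> p = 2 \<and> q = 1 then z else 0)"

definition sparse_mat :: "'a :: comm_ring_1 \<Rightarrow> nat \<Rightarrow> 'a mat" where
  "sparse_mat z n = mat n n (\<lambda>(i, j). tail_entry z (n - i) (n - j))"

lemma sparse_mat_carrier [simp]: "sparse_mat z n \<in> carrier_mat n n"
  by (simp add: sparse_mat_def)

lemma dim_sparse_mat [simp]: "dim_row (sparse_mat z n) = n" "dim_col (sparse_mat z n) = n"
  by (simp_all add: sparse_mat_def)

lemma index_sparse_mat:
  "i < n \<Longrightarrow> j < n \<Longrightarrow> sparse_mat z n $$ (i, j) = tail_entry z (n - i) (n - j)"
  by (simp add: sparse_mat_def)

text \<open>The first off-diagonal of \<open>B B\<^sup>T\<close> vanishes by the cancellation \<open>1 \<cdot> 1 + (-1) \<cdot> 1 = 0\<close>, except in the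
  last row and column, where the second product is cut off. Such truncated sums, caused by
  \<open>N N\<^sup>T \<noteq> I\<close>, make up the irregular corner.\<close>

lemma sparse_mat_eq:
  "z \<cdot>\<^sub>m (toeplitz n fib_den * transpose_mat (toeplitz n fib_den))
     - toeplitz n fib_num * transpose_mat (toeplitz n fib_num) = sparse_mat z n"
  (is "z \<cdot>\<^sub>m ?B - ?A = _")
proof (rule eq_matI)
  fix i j assume "i < dim_row (sparse_mat z n)" "j < dim_col (sparse_mat z n)"
  hence ij: "i < n" "j < n" by (auto simp: sparse_mat_def)
  define e where "e = max i j - min i j"
  define p where "p = n - max i j"
  have B: "?B $$ (i, j) =
      fib_den $ e * fib_den $ 0 + (if p \<ge> 2 then fib_den $ (e + 1) * fib_den $ 1 else 0)
        + (if p \<ge> 3 then fib_den $ (e + 2) * fib_den $ 2 else 0)"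
    by (rule index_toeplitz_gram_quadratic) (use ij in \<open>auto simp: fib_den_nth e_def p_def\<close>)
  have A: "?A $$ (i, j) =
      fib_num $ e * fib_num $ 0 + (if p \<ge> 2 then fib_num $ (e + 1) * fib_num $ 1 else 0)
        + (if p \<ge> 3 then fib_num $ (e + 2) * fib_num $ 2 else 0)"
    by (rule index_toeplitz_gram_quadratic) (use ij in \<open>auto simp: fib_num_nth e_def p_def\<close>)
  have p: "p \<ge> 1" using ij by (simp add: p_def)
  have "tail_entry z (n - i) (n - j) = tail_entry z (p + e) p"
  proof (cases "i \<le> j")
    case True
    hence "n - i = p + e" "n - j = p" using ij by (auto simp: p_def e_def)
    thus ?thesis by simp
  next
    case False
    hence "n - j = p + e" "n - i = p" using ij by (auto simp: p_def e_def)
    thus ?thesis by (auto simp: tail_entry_def)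
  qed
  also have "\<dots> = z * (fib_den $ e * fib_den $ 0 + (if p \<ge> 2 then fib_den $ (e + 1) * fib_den $ 1 else 0)
        + (if p \<ge> 3 then fib_den $ (e + 2) * fib_den $ 2 else 0))
     - (fib_num $ e * fib_num $ 0 + (if p \<ge> 2 then fib_num $ (e + 1) * fib_num $ 1 else 0)
        + (if p \<ge> 3 then fib_num $ (e + 2) * fib_num $ 2 else 0))"
    using p by (auto simp: tail_entry_def fib_den_nth fib_num_nth algebra_simps)
  also have "\<dots> = z * ?B $$ (i, j) - ?A $$ (i, j)" by (simp only: A B)
  finally show "(z \<cdot>\<^sub>m ?B - ?A) $$ (i, j) = sparse_mat z n $$ (i, j)"
    using ij by (simp add: index_sparse_mat)
qed (auto simp: sparse_mat_def)

text \<open>Conjugation by the unimodular \<open>B\<close> clears the denominator of \<open>U\<close>: from \<open>B U = A\<close> follows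
  \<open>B (z I - U U\<^sup>T) B\<^sup>T = z B B\<^sup>T - A A\<^sup>T\<close>.\<close>

lemma poly_char_poly_Z:
  "poly (char_poly (map_mat complex_of_real (Z n))) z = det (sparse_mat z n)"
proof -
  let ?U = "toeplitz n fib_fps :: complex mat"
  let ?B = "toeplitz n fib_den :: complex mat"
  let ?A = "toeplitz n fib_num :: complex mat"
  let ?Z = "?U * transpose_mat ?U"
  have BU: "?B * ?U = ?A" by (simp add: toeplitz_mult fib_den_mult_fib_fps)
  have [simp]: "det ?B = 1" by (simp add: det_toeplitz fib_den_nth)
  have c: "?B \<in> carrier_mat n n" "?U \<in> carrier_mat n n" "?A \<in> carrier_mat n n"
    "transpose_mat ?B \<in> carrier_mat n n" "transpose_mat ?U \<in> carrier_mat n n"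
    "?Z \<in> carrier_mat n n" "z \<cdot>\<^sub>m 1\<^sub>m n \<in> carrier_mat n n"
    by (auto intro!: mult_carrier_mat[of _ n n])
  have D: "z \<cdot>\<^sub>m 1\<^sub>m n - ?Z \<in> carrier_mat n n"
    using c by (intro minus_carrier_mat) auto
  have "?B * (z \<cdot>\<^sub>m 1\<^sub>m n - ?Z) * transpose_mat ?B =
      ?B * (z \<cdot>\<^sub>m 1\<^sub>m n) * transpose_mat ?B - ?B * ?Z * transpose_mat ?B"
    by (simp only: mult_minus_distrib_mat[OF c(1,7,6)]
        minus_mult_distrib_mat[OF mult_carrier_mat[OF c(1,7)] mult_carrier_mat[OF c(1,6)] c(4)])
  also have "?B * (z \<cdot>\<^sub>m 1\<^sub>m n) * transpose_mat ?B = z \<cdot>\<^sub>m (?B * transpose_mat ?B)"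
    by (simp only: mult_smult_distrib[OF c(1) one_carrier_mat] right_mult_one_mat[OF c(1)]
        mult_smult_assoc_mat[OF c(1,4)])
  also have "?B * ?Z * transpose_mat ?B = (?B * ?U) * transpose_mat (?B * ?U)"
    by (simp only: transpose_mult[OF c(1,2)] assoc_mult_mat[OF c(1,2,5)]
        assoc_mult_mat[OF mult_carrier_mat[OF c(1,2)] c(5,4), symmetric])
  finally have eq: "?B * (z \<cdot>\<^sub>m 1\<^sub>m n - ?Z) * transpose_mat ?B = sparse_mat z n"
    by (simp only: BU sparse_mat_eq)
  have "poly (char_poly (map_mat complex_of_real (Z n))) z = det (z \<cdot>\<^sub>m 1\<^sub>m n - ?Z)"
    unfolding Z_eq_toeplitz_gram by (rule poly_char_poly_eq_det[OF c(6)])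
  also have "\<dots> = det (?B * (z \<cdot>\<^sub>m 1\<^sub>m n - ?Z) * transpose_mat ?B)"
    using c(1) by (simp add: det_mult[OF mult_carrier_mat[OF c(1) D] c(4)] det_mult[OF c(1) D]
        det_transpose[OF c(1)])
  finally show ?thesis by (simp only: eq)
qed

section \<open>A recurrence for the sparse determinant\<close>

text \<open>Laplace expansion along row \<open>0\<close> and then along column \<open>0\<close> of the minor belonging to \<open>k\<close>.
  The two signs \<open>(-1) ^ k\<close> and \<open>(-1) ^ (k - 1)\<close> combine to the minus sign.\<close>

lemma det_sparse_first_row_col:
  fixes A :: "'a :: comm_ring_1 mat"
  assumes A: "A \<in> carrier_mat n n" and k: "0 < k" "k < n"
    and row: "\<And>j. j < n \<Longrightarrow> j \<noteq> 0 \<Longrightarrow> j \<noteq> k \<Longrightarrow> A $$ (0, j) = 0"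
    and col: "\<And>i. i < n \<Longrightarrow> i \<noteq> 0 \<Longrightarrow> i \<noteq> k \<Longrightarrow> A $$ (i, 0) = 0"
  shows "det A = A $$ (0, 0) * det (mat_delete A 0 0)
    - A $$ (0, k) * A $$ (k, 0) * det (mat_delete (mat_delete A 0 0) (k - 1) (k - 1))"
proof -
  let ?M = "mat_delete A 0 k"
  have M: "?M \<in> carrier_mat (n - 1) (n - 1)" using A by (rule mat_delete_carrier)
  have "det A = (\<Sum>j<n. A $$ (0, j) * cofactor A 0 j)"
    using A k by (intro laplace_expansion_row) auto
  also have "\<dots> = (\<Sum>j\<in>{0, k}. A $$ (0, j) * cofactor A 0 j)"
    using k row by (intro sum.mono_neutral_right) auto
  also have "\<dots> = A $$ (0, 0) * det (mat_delete A 0 0) + A $$ (0, k) * ((-1) ^ k * det ?M)"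
    using k by (simp add: cofactor_def)
  also have "det ?M = (\<Sum>i<n - 1. ?M $$ (i, 0) * cofactor ?M i 0)"
    using k M by (intro laplace_expansion_column) auto
  also have "\<dots> = (\<Sum>i\<in>{k - 1}. ?M $$ (i, 0) * cofactor ?M i 0)"
  proof (intro sum.mono_neutral_right ballI)
    fix i assume "i \<in> {..<n - 1} - {k - 1}"
    thus "?M $$ (i, 0) * cofactor ?M i 0 = 0"
      using A k col[of "Suc i"] by (auto simp: mat_delete_def)
  qed (use k in auto)
  also have "\<dots> = A $$ (k, 0) * ((-1) ^ (k - 1) * det (mat_delete ?M (k - 1) 0))"
    using A k by (simp add: cofactor_def mat_delete_def)
  also have "mat_delete ?M (k - 1) 0 = mat_delete (mat_delete A 0 0) (k - 1) (k - 1)"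
    using A k by (intro eq_matI) (auto simp: mat_delete_def)
  finally show ?thesis
    using k by (cases k) (simp_all add: algebra_simps flip: power_add)
qed

lemma det_sparse_mat_1: "det (sparse_mat z 1) = z - 1"
  by (subst det_single) (auto simp: index_sparse_mat tail_entry_def)

lemma mat_delete_sparse_mat: "mat_delete (sparse_mat z (Suc n)) 0 0 = sparse_mat z n"
  by (rule eq_matI) (auto simp: mat_delete_def index_sparse_mat)

lemma det_sparse_mat_2: "det (sparse_mat z 2) = (2 * z - 1) * (z - 1) - z\<^sup>2"
proof -
  have "det (sparse_mat z 2) = sparse_mat z 2 $$ (0, 0) * det (mat_delete (sparse_mat z 2) 0 0)
    - sparse_mat z 2 $$ (0, 1) * sparse_mat z 2 $$ (1, 0) *
      det (mat_delete (mat_delete (sparse_mat z 2) 0 0) (1 - 1) (1 - 1))"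
    by (rule det_sparse_first_row_col[of _ 2]) (auto simp: index_sparse_mat)
  moreover have "mat_delete (sparse_mat z 2) 0 0 = sparse_mat z 1"
    using mat_delete_sparse_mat[of z 1] by (simp add: numeral_2_eq_2)
  moreover have "mat_delete (sparse_mat z 1) 0 0 = sparse_mat z 0"
    using mat_delete_sparse_mat[of z 0] by simp
  moreover have "det (sparse_mat z 0) = 1" by simp
  ultimately show ?thesis
    using det_sparse_mat_1[of z]
    by (simp add: power2_eq_square index_sparse_mat tail_entry_def)
qed

lemma det_sparse_mat_expand:
  "det (sparse_mat z (n + 3)) = (3 * z - 2) * det (sparse_mat z (n + 2))
    - (1 - z)\<^sup>2 * det (mat_delete (sparse_mat z (n + 2)) 1 1)"
proof -
  have "det (sparse_mat z (n + 3)) =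
    sparse_mat z (n + 3) $$ (0, 0) * det (mat_delete (sparse_mat z (n + 3)) 0 0)
    - sparse_mat z (n + 3) $$ (0, 2) * sparse_mat z (n + 3) $$ (2, 0) *
      det (mat_delete (mat_delete (sparse_mat z (n + 3)) 0 0) (2 - 1) (2 - 1))"
    by (intro det_sparse_first_row_col[of _ "n + 3"])
       (auto simp: index_sparse_mat tail_entry_def)
  moreover have "mat_delete (sparse_mat z (n + 3)) 0 0 = sparse_mat z (n + 2)"
    using mat_delete_sparse_mat[of z "n + 2"] by (simp add: numeral_3_eq_3)
  ultimately show ?thesis
    by (simp add: power2_eq_square index_sparse_mat tail_entry_def)
qed

lemma det_sparse_mat_3:
  "det (sparse_mat z 3) = (3 * z - 2) * det (sparse_mat z 2) - (1 - z)\<^sup>2 * (2 * z - 1)"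
proof -
  have "det (mat_delete (sparse_mat z 2) 1 1) = 2 * z - 1"
    by (subst det_single) (auto simp: mat_delete_def index_sparse_mat tail_entry_def)
  thus ?thesis using det_sparse_mat_expand[of z 0] by (simp only: add_0)
qed

text \<open>Near the top, the matrix couples each index only to those at distance two. Removing indices \<open>0\<close> and
  \<open>2\<close> therefore leaves index \<open>1\<close> coupled to \<open>3\<close> alone, and these two are adjacent in the reduced matrix
  \<open>E\<close>: a second expansion returns to the family \<open>sparse_mat\<close>. The sizes \<open>n + 4\<close> keep
  the indices \<open>0\<close> and \<open>1\<close> clear of the irregular corner.\<close>

lemma det_sparse_mat_rec:
  "det (sparse_mat z (n + 4)) = (3 * z - 2) * det (sparse_mat z (n + 3))
    - (1 - z)\<^sup>2 * ((3 * z - 2) * det (sparse_mat z (n + 1)) - (1 - z)\<^sup>2 * det (sparse_mat z n))"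
proof -
  let ?E = "mat_delete (sparse_mat z (n + 3)) 1 1"
  have E: "?E \<in> carrier_mat (n + 2) (n + 2)"
    using mat_delete_carrier[of "sparse_mat z (n + 3)" "n + 3" "n + 3" 1 1]
    by (simp add: index_sparse_mat)
  have del: "mat_delete ?E 0 0 = sparse_mat z (n + 1)"
    by (rule eq_matI) (auto simp: mat_delete_def index_sparse_mat)
  have "det ?E = ?E $$ (0, 0) * det (mat_delete ?E 0 0)
    - ?E $$ (0, 1) * ?E $$ (1, 0) * det (mat_delete (mat_delete ?E 0 0) (1 - 1) (1 - 1))"
    using E by (rule det_sparse_first_row_col)
       (auto simp: mat_delete_def index_sparse_mat tail_entry_def)
  also have "\<dots> = (3 * z - 2) * det (sparse_mat z (n + 1)) - (1 - z)\<^sup>2 * det (sparse_mat z n)"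
    unfolding del using mat_delete_sparse_mat[of z n]
    by (simp add: mat_delete_def index_sparse_mat
        tail_entry_def power2_eq_square)
  finally have E_det: "det ?E = \<dots>" .
  have "n + 4 = n + 1 + 3" "n + 3 = n + 1 + 2" by simp_all
  thus ?thesis using det_sparse_mat_expand[of z "n + 1"] E_det by (simp only:)
qed

section \<open>Solving the recurrence\<close>

lemma recurrence_4_unique:
  fixes f g :: "nat \<Rightarrow> 'a"
  assumes f: "\<And>n. f (n + 4) = h (f (n + 3)) (f (n + 1)) (f n)"
    and g: "\<And>n. g (n + 4) = h (g (n + 3)) (g (n + 1)) (g n)"
    and init: "f 0 = g 0" "f 1 = g 1" "f 2 = g 2" "f 3 = g 3"
  shows "f n = g n"
proof (induction n rule: less_induct)
  case (less n)
  show ?case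
  proof (cases "n < 4")
    case True
    hence "n = 0 \<or> n = 1 \<or> n = 2 \<or> n = 3" by auto
    thus ?thesis using init by auto
  next
    case False
    then obtain m where "n = m + 4" by (metis add.commute le_Suc_ex linorder_not_less)
    thus ?thesis using less[of m] less[of "m + 1"] less[of "m + 3"] by (simp only: f g)
  qed
qed

text \<open>The numbers \<open>r\<close> and \<open>s\<close> enter only through their sum and product, so no choice of square root
  is involved and the case \<open>r = s\<close> is covered. The initial values come from the power sums
  \<open>r + s\<close>, \<open>r\<^sup>2 + s\<^sup>2\<close> and \<open>r\<^sup>3 + s\<^sup>3\<close>. Starting at \<open>n = 0\<close> is possible because \<open>(z - 1) ^ (n - 1)\<close> is
  written as \<open>(z - 1) ^ n / (z - 1)\<close>.\<close>

lemma det_sparse_mat_closed_form: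
  fixes z r s :: complex
  assumes z: "z \<noteq> 1" "5 * z - 4 \<noteq> 0" and sum: "r + s = 3 * z - 2" and prod: "r * s = (z - 1)\<^sup>2"
  shows "det (sparse_mat z n) = (1 / (2 * (z - 1)) + 1) * (z - 1) ^ n
    - z / (2 * (z - 1) * (5 * z - 4)) * (1 - z) ^ n - (r ^ n + s ^ n) / (5 * z - 4)"
proof -
  define a where "a = 3 * z - 2"
  define w where "w = z - 1"
  define v where "v = 5 * z - 4"
  define \<alpha> where "\<alpha> = 1 / (2 * w) + 1"
  define \<beta> where "\<beta> = z / (2 * w * v)"
  define g where "g n = \<alpha> * w ^ n - \<beta> * (- w) ^ n - (r ^ n + s ^ n) / v" for n
  have w: "w \<noteq> 0" and v: "v \<noteq> 0" using z by (auto simp: w_def v_def)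
  have root: "x ^ 4 = a * x ^ 3 - w\<^sup>2 * (a * x - w\<^sup>2)" if "x \<in> {w, - w, r, s}" for x
  proof -
    have "(x - w) * (x + w) * ((x - r) * (x - s)) = 0" using that by auto
    also have "(x - r) * (x - s) = x\<^sup>2 - a * x + w\<^sup>2"
      unfolding a_def w_def prod[symmetric] sum[symmetric]
      by (simp add: power2_eq_square algebra_simps)
    finally show ?thesis by (simp add: algebra_simps power2_eq_square power3_eq_cube power4_eq_xxxx)
  qed
  have step: "x ^ (n + 4) = a * x ^ (n + 3) - w\<^sup>2 * (a * x ^ (n + 1) - w\<^sup>2 * x ^ n)"
    if "x \<in> {w, - w, r, s}" for x n
    unfolding power_add root[OF that] by (simp add: algebra_simps)
  have "det (sparse_mat z n) = g n"
  proof (rule recurrence_4_unique[where h = "\<lambda>x y u. a * x - w\<^sup>2 * (a * y - w\<^sup>2 * u)"])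
    show "det (sparse_mat z (n + 4)) = a * det (sparse_mat z (n + 3))
        - w\<^sup>2 * (a * det (sparse_mat z (n + 1)) - w\<^sup>2 * det (sparse_mat z n))" for n
      using det_sparse_mat_rec[of z n] by (simp add: a_def w_def power2_commute)
    show "g (n + 4) = a * g (n + 3) - w\<^sup>2 * (a * g (n + 1) - w\<^sup>2 * g n)" for n
      unfolding g_def step[of w, simplified] step[of "- w", simplified]
        step[of r, simplified] step[of s, simplified]
      using v by (simp add: field_simps)
    have zw: "z = w + 1" "v = 5 * w + 1" "a = 3 * w + 1" by (simp_all add: w_def v_def a_def)
    have p1: "r + s = a" using sum by (simp add: a_def)
    have rs: "r * s = w\<^sup>2" using prod by (simp add: w_def)
    have p2: "r\<^sup>2 + s\<^sup>2 = a\<^sup>2 - 2 * w\<^sup>2"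
      unfolding p1[symmetric] rs[symmetric] by (simp add: power2_eq_square algebra_simps)
    have p3: "r ^ 3 + s ^ 3 = a ^ 3 - 3 * a * w\<^sup>2"
      unfolding p1[symmetric] rs[symmetric] by (simp add: power3_eq_cube algebra_simps)
    have v': "5 * w + 1 \<noteq> 0" using v zw by simp
    \<comment> \<open>multiples of \<open>v\<close> in the form in which they occur as denominators after normalisation\<close>
    have eqs: "2 + w * 10 = 2 * (5 * w + 1)" "4 + w * 20 = 4 * (5 * w + 1)"
      by (simp_all add: algebra_simps)
    have v'': "2 + w * 10 \<noteq> 0" "4 + w * 20 \<noteq> 0" using v' unfolding eqs by (simp_all del: distrib_left_numeral)
    show "det (sparse_mat z 0) = g 0"
      using w v' v''
      by (simp add: sparse_mat_def g_def \<alpha>_def \<beta>_def zw divide_simps) (simp add: algebra_simps)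
    have "g 1 = w" unfolding g_def power_one_right p1
      using w v' v''
      by (simp add: \<alpha>_def \<beta>_def zw divide_simps) (simp add: algebra_simps)
    thus "det (sparse_mat z 1) = g 1" using det_sparse_mat_1[of z] by (simp add: w_def)
    have g2: "g 2 = (2 * z - 1) * (z - 1) - z\<^sup>2" unfolding g_def p2
      using w v' v''
      by (simp add: \<alpha>_def \<beta>_def zw divide_simps) (simp add: algebra_simps power2_eq_square)
    thus D2: "det (sparse_mat z 2) = g 2" using det_sparse_mat_2[of z] by simp
    have "g 3 = a * ((2 * z - 1) * (z - 1) - z\<^sup>2) - w\<^sup>2 * (2 * z - 1)" unfolding g_def p3
      using w v' v''
      by (simp add: \<alpha>_def \<beta>_def zw divide_simps) (simp add: algebra_simps power2_eq_square power3_eq_cube)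
    thus "det (sparse_mat z 3) = g 3" using det_sparse_mat_3[of z] D2 g2
      by (simp add: a_def w_def power2_commute)
  qed
  thus ?thesis by (simp add: g_def \<alpha>_def \<beta>_def w_def v_def)
qed

theorem lemma2p1:
  fixes n :: nat and z :: complex
  assumes "n \<ge> 1" and "z \<notin> {4 / 5, 1}"
  shows "poly (char_poly (map_mat complex_of_real (Z n))) z =
      1 / 2 * (z - 1) ^ (n - 1) + (z - 1) ^ n
      - z * (1 - z) ^ n / (8 - 18 * z + 10 * z\<^sup>2)
      + (2 powi (- int n) * (- 2 + 3 * z - csqrt z * csqrt (5 * z - 4)) ^ n
         + 2 powi (- int n) * (- 2 + 3 * z + csqrt z * csqrt (5 * z - 4)) ^ n)
        / (4 - 5 * z)"
proof -
  define q where "q = csqrt z * csqrt (5 * z - 4)"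
  define r where "r = (- 2 + 3 * z - q) / 2"
  define s where "s = (- 2 + 3 * z + q) / 2"
  have q2: "q\<^sup>2 = z * (5 * z - 4)" by (simp add: q_def power_mult_distrib)
  have z: "z \<noteq> 1" "5 * z - 4 \<noteq> 0" using assms(2) by (auto simp: field_simps)
  have sum: "r + s = 3 * z - 2" by (simp add: r_def s_def field_simps)
  have "4 * (r * s) = (3 * z - 2)\<^sup>2 - q\<^sup>2"
    by (simp add: r_def s_def field_simps power2_eq_square)
  also have "\<dots> = 4 * (z - 1)\<^sup>2" unfolding q2 by (simp add: power2_eq_square algebra_simps)
  finally have prod: "r * s = (z - 1)\<^sup>2" by simp
  have pw: "2 powi (- int n) * x ^ n = (x / 2) ^ n" for x :: complex
    by (simp add: power_int_minus power_divide field_simps)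
  have den: "8 - 18 * z + 10 * z\<^sup>2 = 2 * (z - 1) * (5 * z - 4)"
    by (simp add: power2_eq_square algebra_simps)
  have pred: "1 / 2 * (z - 1) ^ (n - 1) = 1 / (2 * (z - 1)) * (z - 1) ^ n"
    using assms(1) z(1) by (cases n) (simp_all add: divide_simps)
  have neg: "x / (4 - 5 * z) = - (x / (5 * z - 4))" for x
    by (metis minus_diff_eq divide_minus_right)
  show ?thesis
    unfolding poly_char_poly_Z det_sparse_mat_closed_form[OF z sum prod] pw den pred neg
    by (simp add: r_def s_def q_def distrib_right)
qed

end
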